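(* Let $F$ be an arbitrary field, let $R$ be an associative $F$-algebra with non-trivial center, and let $V\subseteq R$ be a vector subspace which generates $R$ as an algebra. Let $c(x_1,\ldots,x_n)$ be a multilinear (non-trivial) central polynomial for the algebra $R$. If $\dim(R)=d$ and $\dim(V)=m$ (finite), then there is a weak central polynomial $c'(x_1,\ldots,x_N)$ for the pair $(R,V)$ such that $1\leq \deg(c')\leq n(d-m+1)$.
   Context: Polynomials are elements of the free associative algebra over $F$. A polynomial $f(x_1,\ldots,x_n)$ is an identity for the pair $(R,V)$ if $f(v_1,\ldots,v_n)=0$ for all $v_1,\ldots,v_n\in V$. A polynomial $c(x_1,\ldots,x_n)$ is a (weak, non-trivial) central polynomial for the pair $(R,V)$ if $c(v_1,\ldots,v_n)$ belongs to the center of $R$ for all $v_1,\ldots,v_n\in V$ and $c$ is not an identity for $(R,V)$. A (non-trivial) central polynomial of the algebra $R$ is a central polynomial for the pair $(R,R)$. Multilinear means linear in each of the variables $x_1,\ldots,x_n$. *)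

theory Defs
  imports Complex_Main "HOL-Library.Poly_Mapping"
begin

text \<open>
  Words form the free monoid, so that \<^typ>\<open>nat list \<Rightarrow>\<^sub>0 'f\<close> with the convolution product of
  \<^theory>\<open>HOL-Library.Poly_Mapping\<close> is the free associative algebra with 1 on countably many
  variables. The variable \<open>x\<^sub>i\<close> of the mathematical text is the one-letter word \<open>[i - 1]\<close>.
\<close>

instantiation list :: (type) monoid_add
begin

definition zero_list :: "'a list" where "zero_list = []"

definition plus_list :: "'a list \<Rightarrow> 'a list \<Rightarrow> 'a list" where "plus_list = (@)"

instance by standard (simp_all add: zero_list_def plus_list_def)

end

type_synonym 'f free_algebra = "nat list \<Rightarrow>\<^sub>0 'f"

definition poly_degree :: "'f::zero free_algebra \<Rightarrow> nat" where
  "poly_degree f = Max (insert 0 (length ` Poly_Mapping.keys f))"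

definition multilinear :: "nat \<Rightarrow> 'f::zero free_algebra \<Rightarrow> bool" where
  "multilinear n f \<longleftrightarrow> (\<forall>w\<in>Poly_Mapping.keys f. \<forall>i<n. count_list w i = 1)"

definition ring_center :: "'r::times set" where
  "ring_center = {z. \<forall>x. z * x = x * z}"

text \<open>
  The algebra \<open>R\<close> is the whole type \<open>'r\<close>, whose multiplication need not have an identity element.
  The parameter \<open>one_opt\<close> selects the category in which \<open>R\<close> is considered: \<open>None\<close> stands for
  algebras without distinguished identity (polynomials have no constant term), \<open>Some e\<close> for unital
  algebras with identity \<open>e\<close> (subalgebras contain \<open>e\<close>, constant terms are allowed and
  are evaluated as multiples of \<open>e\<close>).
\<close>

locale assoc_algebra = vector_space scale
  for scale :: "'f::field \<Rightarrow> 'r::ring \<Rightarrow> 'r" (infixr "*s" 75) +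
  fixes one_opt :: "'r option"
  assumes scale_mult_left: "(a *s x) * y = a *s (x * y)"
    and scale_mult_right: "x * (a *s y) = a *s (x * y)"
    and one_left: "one_opt = Some e \<Longrightarrow> e * x = x"
    and one_right: "one_opt = Some e \<Longrightarrow> x * e = x"
begin

definition subalgebra :: "'r set \<Rightarrow> bool" where
  "subalgebra A \<longleftrightarrow> subspace A \<and> (\<forall>x\<in>A. \<forall>y\<in>A. x * y \<in> A) \<and> set_option one_opt \<subseteq> A"

definition generates :: "'r set \<Rightarrow> bool" where
  "generates V \<longleftrightarrow> subalgebra hull V = UNIV"

text \<open>The polynomials in the first \<open>n\<close> variables.\<close>

definition polys :: "nat \<Rightarrow> 'f free_algebra set" where
  "polys n = {f. (\<forall>w\<in>Poly_Mapping.keys f. set w \<subseteq> {..<n}) \<and>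
                 (one_opt = None \<longrightarrow> [] \<notin> Poly_Mapping.keys f)}"

text \<open>The value \<open>0\<close> of the empty word for \<open>one_opt = None\<close> is a dummy: by \<open>polys\<close>, the empty
  word does not occur in that case.\<close>

fun eval_word :: "(nat \<Rightarrow> 'r) \<Rightarrow> nat list \<Rightarrow> 'r" where
  "eval_word v [] = (case one_opt of None \<Rightarrow> 0 | Some e \<Rightarrow> e)"
| "eval_word v [i] = v i"
| "eval_word v (i # j # w) = v i * eval_word v (j # w)"

definition eval_poly :: "(nat \<Rightarrow> 'r) \<Rightarrow> 'f free_algebra \<Rightarrow> 'r" where
  "eval_poly v f = (\<Sum>w\<in>Poly_Mapping.keys f. Poly_Mapping.lookup f w *s eval_word v w)"

definition identity_for :: "'r set \<Rightarrow> nat \<Rightarrow> 'f free_algebra \<Rightarrow> bool" where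
  "identity_for V n f \<longleftrightarrow> f \<in> polys n \<and> (\<forall>v. (\<forall>i<n. v i \<in> V) \<longrightarrow> eval_poly v f = 0)"

text \<open>Central polynomials for the pair \<open>(R, V)\<close>; those of \<open>R\<close> itself are the case
  \<open>V = UNIV\<close>.\<close>

definition central_polynomial_for :: "'r set \<Rightarrow> nat \<Rightarrow> 'f free_algebra \<Rightarrow> bool" where
  "central_polynomial_for V n f \<longleftrightarrow>
     f \<in> polys n \<and> (\<forall>v. (\<forall>i<n. v i \<in> V) \<longrightarrow> eval_poly v f \<in> ring_center) \<and> \<not> identity_for V n f"

end

end

theory Submission
  imports Defs
begin

text \<open>
  Let \<open>T k\<close> be the span of the values, at a basis of \<open>V\<close>, of the words of length at most \<open>k\<close>.
  If \<open>T k = T (k + 1)\<close> for some \<open>k \<ge> 1\<close>, then \<open>T k\<close> is closed under left multiplication by \<open>V\<close>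
  and hence contains all words, so \<open>T k = R\<close>. Thus the dimension grows by at least one in each step
  until \<open>R\<close> is reached, which gives \<open>T (d - m + 1) = R\<close>. By multilinearity \<open>c\<close> does not vanish on
  some words of length at most \<open>d - m + 1\<close>, and substituting these words into \<open>c\<close> yields a
  homogeneous \<open>c'\<close>. It is constant only if all these words are empty; then
  \<open>c(x, 1, \<dots>, 1) = \<alpha> x\<close> with \<open>\<alpha> \<noteq> 0\<close>, so that \<open>R\<close> is commutative and
  \<open>x + 1\<close> is central; the constant term keeps it from being an identity when \<open>V = 0\<close>.
\<close>

section \<open>Finite bases and their enumeration\<close>

context vector_space
begin

text \<open>A maximal independent subset of a finite spanning set is a finite basis; naming it makes
  the dimension theory of finite-dimensional spaces available.\<close>

lemma finite_spanning_set_imp_basis: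
  assumes "finite A" "span A = UNIV"
  obtains B where "finite_dimensional_vector_space scale B"
proof -
  obtain B where B: "B \<subseteq> A" "independent B" "A \<subseteq> span B"
    by (rule maximal_independent_subset)
  have "span B = UNIV"
    using B(3) assms(2) span_mono[of A "span B"] by (auto simp: span_span)
  then have "finite_dimensional_vector_space scale B"
    using B assms(1) by unfold_locales (auto intro: finite_subset)
  then show thesis by (rule that)
qed

end

text \<open>Numbering a basis of \<open>V\<close> turns it into an assignment of values to the
  variables with index below \<open>N\<close>.\<close>

lemma (in finite_dimensional_vector_space) subspace_finite_enumeration:
  assumes "subspace V"
  obtains b and N :: nat where "b ` {..<N} \<subseteq> V" "V \<subseteq> span (b ` {..<N})"
proof -
  obtain B where B: "B \<subseteq> V" "independent B" "V \<subseteq> span B"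
    by (rule basis_exists)
  then have "finite B" by (blast intro: finiteI_independent)
  then obtain N :: nat and b where "B = b ` {i. i < N}"
    using finite_imp_nat_seg_image_inj_on[of B] by blast
  then have "B = b ` {..<N}" by (simp add: lessThan_def)
  with B show thesis by (intro that[of b N]) simp_all
qed

section \<open>Monomials and degree of multilinear polynomials\<close>

text \<open>\<open>multilinear\<close> only restricts the letters below \<open>n\<close>; together
  with the bound on the letters, every monomial becomes a permutation of the \<open>n\<close>
  variables.\<close>

lemma multilinear_keys:
  assumes "multilinear n c" "\<And>w. w \<in> Poly_Mapping.keys c \<Longrightarrow> set w \<subseteq> {..<n}"
    and "w \<in> Poly_Mapping.keys c"
  shows "set w = {..<n}" and "\<And>i. i < n \<Longrightarrow> count_list w i = 1"
proof -
  show count: "count_list w i = 1" if "i < n" for i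
    using assms(1,3) that by (auto simp: multilinear_def)
  have "i \<in> set w" if "i < n" for i
    using count[OF that] by (metis count_notin zero_neq_one)
  with assms(2)[OF assms(3)] show "set w = {..<n}" by auto
qed

lemma poly_degree_eqI:
  assumes "\<And>w. w \<in> Poly_Mapping.keys f \<Longrightarrow> length w \<le> L"
    and "w \<in> Poly_Mapping.keys f" "length w = L"
  shows "poly_degree f = L"
  unfolding poly_degree_def using assms by (intro Max_eqI) auto

section \<open>Evaluation of words\<close>

context assoc_algebra
begin

definition words :: "nat \<Rightarrow> nat list set" where
  "words N = {w. set w \<subseteq> {..<N} \<and> (one_opt = None \<longrightarrow> w \<noteq> [])}"

lemma polys_iff_keys_subset_words: "f \<in> polys N \<longleftrightarrow> Poly_Mapping.keys f \<subseteq> words N"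
  by (auto simp: polys_def words_def)

declare eval_word.simps(1) [simp del]

lemma unital_obtain:
  assumes "one_opt \<noteq> None"
  obtains e where "one_opt = Some e" "\<And>v. eval_word v [] = e" "\<And>x. e * x = x" "\<And>x. x * e = x"
proof -
  from assms obtain e where e: "one_opt = Some e" by blast
  have "eval_word v [] = e" for v
    by (subst eval_word.simps(1)) (simp add: e)
  with e one_left[OF e] one_right[OF e] that show thesis by blast
qed

text \<open>If there is no identity, \<open>[]\<close> has the dummy value \<open>0\<close>, which
  would annihilate the product; the hypothesis excludes this case.\<close>

lemma eval_word_Cons:
  assumes "one_opt = None \<Longrightarrow> w \<noteq> []"
  shows "eval_word v (i # w) = v i * eval_word v w"
proof (cases w)
  case Nil
  with assms have "one_opt \<noteq> None" by blast
  then obtain e where "\<And>v. eval_word v [] = e" "\<And>x. x * e = x"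
    using unital_obtain by blast
  with Nil show ?thesis by simp
qed simp

lemma eval_word_append:
  assumes "one_opt = None \<Longrightarrow> u \<noteq> [] \<and> w \<noteq> []"
  shows "eval_word v (u @ w) = eval_word v u * eval_word v w"
  using assms
proof (induction u)
  case Nil
  then have "one_opt \<noteq> None" by blast
  then obtain e where "\<And>v. eval_word v [] = e" "\<And>x. e * x = x"
    using unital_obtain by blast
  then show ?case by simp
next
  case (Cons i u)
  show ?case
  \<comment> \<open>In the first case \<open>u\<close> has only the dummy value, so the induction
    hypothesis does not apply and the letter is split off directly.\<close>
  proof (cases "u = [] \<and> one_opt = None")
    case True
    with Cons.prems have "u = []" "w \<noteq> []" by auto
    then show ?thesis by (simp add: eval_word_Cons)
  next
    case False
    then have IH: "eval_word v (u @ w) = eval_word v u * eval_word v w"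
      using Cons by blast
    have "eval_word v (i # u @ w) = v i * eval_word v (u @ w)"
      using Cons.prems by (intro eval_word_Cons) auto
    moreover have "eval_word v (i # u) = v i * eval_word v u"
      using False by (intro eval_word_Cons) auto
    ultimately show ?thesis
      using IH by (simp add: mult.assoc)
  qed
qed

lemma eval_word_concat:
  assumes "one_opt = None \<Longrightarrow> w \<noteq> [] \<and> (\<forall>i\<in>set w. u i \<noteq> [])"
  shows "eval_word v (concat (map u w)) = eval_word (\<lambda>i. eval_word v (u i)) w"
  using assms
proof (induction w rule: induct_list012)
  case (3 i j w)
  have "eval_word v (u i @ concat (map u (j # w))) =
      eval_word v (u i) * eval_word v (concat (map u (j # w)))"
    using "3.prems" by (intro eval_word_append) auto
  with 3 show ?case by simp
qed (simp_all add: eval_word.simps(1))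

lemma eval_word_cong:
  assumes "\<And>i. i \<in> set w \<Longrightarrow> v i = v' i"
  shows "eval_word v w = eval_word v' w"
  using assms by (induction w rule: induct_list012) (auto simp: eval_word.simps(1))

lemma eval_word_upd_notin: "i \<notin> set w \<Longrightarrow> eval_word (v(i := x)) w = eval_word v w"
  by (rule eval_word_cong) auto

lemma eval_word_upd_Cons:
  assumes "i \<notin> set w" "one_opt = None \<Longrightarrow> w \<noteq> []"
  shows "eval_word (v(i := x)) (i # w) = x * eval_word v w"
  using eval_word_Cons[OF assms(2)] eval_word_upd_notin[OF assms(1)] by simp

text \<open>If the single occurrence of \<open>i\<close> is the head, the tail does not see the
  update and distributivity from the right applies. Otherwise the head does not see it, and the
  induction hypothesis for the tail is multiplied from the left.\<close>

lemma eval_word_add: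
  assumes "count_list w i = 1"
  shows "eval_word (v(i := x + y)) w = eval_word (v(i := x)) w + eval_word (v(i := y)) w"
  using assms
proof (induction w rule: induct_list012)
  case (3 j k w)
  show ?case
  proof (cases "i = j")
    case True
    with "3.prems" have "i \<notin> set (k # w)" by (simp add: count_list_0_iff split: if_splits)
    then have "eval_word (v(i := x)) (i # k # w) = x * eval_word v (k # w)" for x
      by (rule eval_word_upd_Cons) simp
    then show ?thesis by (simp only: True distrib_right)
  next
    case False
    with 3 show ?thesis by (simp add: distrib_left)
  qed
qed (auto split: if_splits)

lemma eval_word_scale:
  assumes "count_list w i = 1"
  shows "eval_word (v(i := a *s x)) w = a *s eval_word (v(i := x)) w"
  using assms
proof (induction w rule: induct_list012)
  case (3 j k w)
  show ?case
  proof (cases "i = j")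
    case True
    with "3.prems" have "i \<notin> set (k # w)" by (simp add: count_list_0_iff split: if_splits)
    then have "eval_word (v(i := x)) (i # k # w) = x * eval_word v (k # w)" for x
      by (rule eval_word_upd_Cons) simp
    then show ?thesis by (simp only: True scale_mult_left)
  next
    case False
    with 3 show ?thesis by (simp add: scale_mult_right)
  qed
qed (auto split: if_splits)

text \<open>All letters other than \<open>i\<close> take the value \<open>e\<close> and cancel,
  which leaves the one factor \<open>x\<close>.\<close>

lemma eval_word_one_upd:
  assumes "one_opt = Some e" "count_list w i = 1"
  shows "eval_word ((\<lambda>_. e)(i := x)) w = x"
proof -
  have unital: "one_opt \<noteq> None" using assms(1) by simp
  then have Nil: "eval_word v [] = e" for v
    using assms(1) by (metis unital_obtain option.inject)
  have one: "eval_word (\<lambda>_. e) w = e" for w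
    using Nil one_left[OF assms(1)] by (induction w rule: induct_list012) simp_all
  show ?thesis
    using assms(2)
  proof (induction w)
    case (Cons j w)
    show ?case
    proof (cases "i = j")
      case True
      with Cons.prems have "i \<notin> set w" by (simp add: count_list_0_iff)
      then have "eval_word ((\<lambda>_. e)(i := x)) (i # w) = x * eval_word (\<lambda>_. e) w"
        using unital by (intro eval_word_upd_Cons) auto
      then show ?thesis by (simp only: True one one_right[OF assms(1)])
    next
      case False
      with Cons have "eval_word ((\<lambda>_. e)(i := x)) w = x"
        by (metis count_list.simps(2))
      moreover have "eval_word ((\<lambda>_. e)(i := x)) (j # w) =
          ((\<lambda>_. e)(i := x)) j * eval_word ((\<lambda>_. e)(i := x)) w"
        using unital by (intro eval_word_Cons) simp
      moreover have "((\<lambda>_. e)(i := x)) j = e" using False by simp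
      ultimately show ?thesis by (simp only: one_left[OF assms(1)])
    qed
  qed simp
qed

section \<open>Evaluation of polynomials and multilinearity\<close>

text \<open>Added words have coefficient \<open>0\<close>; enlarging the index set lets several
  polynomials be summed over the same words.\<close>

lemma eval_poly_superset:
  assumes "finite S" "Poly_Mapping.keys f \<subseteq> S"
  shows "eval_poly v f = (\<Sum>w\<in>S. Poly_Mapping.lookup f w *s eval_word v w)"
  unfolding eval_poly_def using assms
  by (intro sum.mono_neutral_left) (auto simp: in_keys_iff)

lemma eval_poly_single: "eval_poly v (Poly_Mapping.single w a) = a *s eval_word v w"
  by (subst eval_poly_superset[of "{w}"]) auto

lemma eval_poly_add: "eval_poly v (f + g) = eval_poly v f + eval_poly v g"
proof -
  let ?S = "Poly_Mapping.keys f \<union> Poly_Mapping.keys g"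
  have "Poly_Mapping.keys (f + g) \<subseteq> ?S" by (rule Poly_Mapping.keys_add)
  then show ?thesis
    by (simp add: eval_poly_superset[of ?S] lookup_add scale_left_distrib sum.distrib)
qed

lemma eval_poly_sum: "eval_poly v (\<Sum>x\<in>A. f x) = (\<Sum>x\<in>A. eval_poly v (f x))"
  by (induction A rule: infinite_finite_induct) (simp_all add: eval_poly_add, simp_all add: eval_poly_def)

lemma eval_poly_cong:
  assumes "f \<in> polys n" "\<And>i. i < n \<Longrightarrow> v i = v' i"
  shows "eval_poly v f = eval_poly v' f"
  unfolding eval_poly_def
proof (intro sum.cong refl arg_cong2[where f = scale] eval_word_cong)
  fix w i
  assume "w \<in> Poly_Mapping.keys f" "i \<in> set w"
  with assms(1) have "i < n" by (auto simp: polys_def)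
  then show "v i = v' i" by (rule assms(2))
qed

text \<open>With the other variables fixed, evaluation is a linear map in the variable
  \<open>i\<close>, and this set is its kernel.\<close>

lemma multilinear_subspace_zeros:
  assumes "multilinear n c" "i < n"
  shows "subspace {x. eval_poly (v(i := x)) c = 0}"
proof -
  have count: "count_list w i = 1" if "w \<in> Poly_Mapping.keys c" for w
    using assms that by (auto simp: multilinear_def)
  have add: "eval_poly (v(i := x + y)) c = eval_poly (v(i := x)) c + eval_poly (v(i := y)) c" for x y
    by (simp add: eval_poly_def eval_word_add count scale_right_distrib sum.distrib)
  have scale: "eval_poly (v(i := a *s x)) c = a *s eval_poly (v(i := x)) c" for a x
    by (simp add: eval_poly_def eval_word_scale count scale_sum_right mult.commute)
  from scale[of 0 0] have "eval_poly (v(i := 0)) c = 0" by simp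
  with add scale show ?thesis by (auto simp: subspace_def)
qed

text \<open>By contraposition: vanishing on \<open>S\<close> is extended to the whole algebra one
  variable at a time, since the zeros in one variable form a subspace.\<close>

lemma multilinear_nonzero_on_spanning_set:
  assumes "multilinear n c" "span S = UNIV" "eval_poly v c \<noteq> 0"
  shows "\<exists>u. (\<forall>i<n. u i \<in> S) \<and> eval_poly u c \<noteq> 0"
proof (rule ccontr)
  assume "\<not> ?thesis"
  then have zero: "eval_poly u c = 0" if "\<forall>i<n. u i \<in> S" for u
    using that by blast
  \<comment> \<open>The first \<open>j\<close> variables are free and the remaining ones are
    confined to \<open>S\<close>. At \<open>j = 0\<close> this is the assumed vanishing, at
    \<open>j = n\<close> it covers every assignment.\<close>
  have "j \<le> n \<Longrightarrow> (\<forall>i. j \<le> i \<longrightarrow> i < n \<longrightarrow> u i \<in> S) \<Longrightarrow> eval_poly u c = 0" for j u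
  proof (induction j arbitrary: u)
    case 0
    then show ?case by (intro zero) auto
  next
    case (Suc j)
    have "S \<subseteq> {x. eval_poly (u(j := x)) c = 0}"
      using Suc.prems by (auto intro!: Suc.IH simp: Suc_le_eq)
    then have "span S \<subseteq> {x. eval_poly (u(j := x)) c = 0}"
      using Suc.prems(1) assms(1) by (intro span_minimal multilinear_subspace_zeros) auto
    then have "eval_poly (u(j := u j)) c = 0"
      using assms(2) by blast
    then show ?case by simp
  qed
  from this[of n v] assms(3) show False by simp
qed

section \<open>Words in a basis of \<open>V\<close> span the algebra\<close>

text \<open>The product is bilinear: with the left factor in \<open>S\<close>, the right factor is
  extended to the span first, and then the left factor.\<close>

lemma span_mult_closed:
  assumes "\<And>x y. x \<in> S \<Longrightarrow> y \<in> S \<Longrightarrow> x * y \<in> S" "x \<in> span S" "y \<in> span S"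
  shows "x * y \<in> span S"
proof -
  have "subspace {x. x * y \<in> span S}" for y
    by (auto simp: subspace_def distrib_right scale_mult_left span_add span_scale span_zero)
  moreover have "subspace {y. x * y \<in> span S}" for x
    by (auto simp: subspace_def distrib_left scale_mult_right span_add span_scale span_zero)
  moreover have "span S \<subseteq> {y. x * y \<in> span S}" if "x \<in> S" for x
    using assms(1) that calculation(2) by (intro span_minimal) (auto intro: span_base)
  ultimately have "span S \<subseteq> {x. x * y \<in> span S}"
    using assms(3) by (intro span_minimal) auto
  with assms(2) show ?thesis by blast
qed

text \<open>Concatenation makes the word values closed under products, and \<open>[]\<close>
  supplies the identity if there is one. Their span is thus a subalgebra containing
  \<open>V\<close>.\<close>

lemma span_words_UNIV:
  assumes "generates V" "V \<subseteq> span (b ` {..<N})"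
  shows "span (eval_word b ` words N) = UNIV"
proof -
  let ?S = "eval_word b ` words N"
  have "x * y \<in> ?S" if xy: "x \<in> ?S" "y \<in> ?S" for x y
  proof -
    obtain w w' where "w \<in> words N" "w' \<in> words N" "x = eval_word b w" "y = eval_word b w'"
      using xy by blast
    then have "x * y = eval_word b (w @ w')" "w @ w' \<in> words N"
      by (auto simp: words_def eval_word_append)
    then show ?thesis by blast
  qed
  moreover have "e \<in> ?S" if "one_opt = Some e" for e
  proof (rule image_eqI)
    show "e = eval_word b []"
      by (subst eval_word.simps(1)) (simp add: that)
    show "[] \<in> words N"
      using that by (subst words_def) simp
  qed
  ultimately have "subalgebra (span ?S)"
    by (auto simp: subalgebra_def span_mult_closed intro: span_base)
  moreover have "b ` {..<N} \<subseteq> ?S"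
  proof
    fix x assume "x \<in> b ` {..<N}"
    then obtain i where "i < N" "x = b i" by auto
    then show "x \<in> ?S" by (intro image_eqI[where x = "[i]"]) (auto simp: words_def)
  qed
  then have "V \<subseteq> span ?S"
    using assms(2) span_mono by blast
  ultimately have "subalgebra hull V \<subseteq> span ?S"
    by (intro hull_minimal)
  with assms(1) show ?thesis by (auto simp: generates_def)
qed

section \<open>Growth of the spans of short words\<close>

text \<open>The space \<open>T k\<close> of the overview; if there is an identity, it lies in every
  \<open>T k\<close> as the value of \<open>[]\<close>.\<close>

definition short_word_span :: "(nat \<Rightarrow> 'r) \<Rightarrow> nat \<Rightarrow> nat \<Rightarrow> 'r set" where
  "short_word_span b N k = span (eval_word b ` {w \<in> words N. length w \<le> k})"

lemma short_word_span_mono: "k \<le> l \<Longrightarrow> short_word_span b N k \<subseteq> short_word_span b N l"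
  unfolding short_word_span_def by (intro span_mono) auto

lemma span_subset_short_word_span_1: "span (b ` {..<N}) \<subseteq> short_word_span b N 1"
  unfolding short_word_span_def
proof (intro span_mono subsetI)
  fix x assume "x \<in> b ` {..<N}"
  then obtain i where "i < N" "x = b i" by auto
  then show "x \<in> eval_word b ` {w \<in> words N. length w \<le> 1}"
    by (intro image_eqI[where x = "[i]"]) (auto simp: words_def)
qed

text \<open>Left multiplication by \<open>b i\<close> is linear and prefixes one letter to each
  word.\<close>

lemma short_word_span_left_mult:
  assumes "i < N" "x \<in> short_word_span b N k"
  shows "b i * x \<in> short_word_span b N (Suc k)"
proof -
  have "subspace {x. b i * x \<in> short_word_span b N (Suc k)}"
    unfolding short_word_span_def
    by (auto simp: subspace_def distrib_left scale_mult_right span_add span_scale span_zero)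
  moreover have "b i * eval_word b w \<in> short_word_span b N (Suc k)"
    if "w \<in> words N" "length w \<le> k" for w
    unfolding short_word_span_def using that assms(1)
    by (intro span_base image_eqI[where x = "i # w"]) (auto simp: words_def eval_word_Cons)
  ultimately have "short_word_span b N k \<subseteq> {x. b i * x \<in> short_word_span b N (Suc k)}"
    unfolding short_word_span_def[of b N k] by (intro span_minimal) auto
  with assms(2) show ?thesis by blast
qed

lemma short_word_span_stable:
  assumes "generates V" "V \<subseteq> span (b ` {..<N})"
    and "short_word_span b N (Suc (Suc k)) = short_word_span b N (Suc k)"
  shows "short_word_span b N (Suc k) = UNIV"
proof -
  have "w \<in> words N \<Longrightarrow> eval_word b w \<in> short_word_span b N (Suc k)" for w
  proof (induction w)
    case Nil
    then show ?case
      unfolding short_word_span_def by (intro span_base) auto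
  next
    case (Cons i w)
    then have "i < N" by (auto simp: words_def)
    show ?case
    \<comment> \<open>A single letter lies in the span because its length \<open>1\<close> is at
      most \<open>Suc k\<close>; without an identity its empty tail would not be an admissible word
      for the induction hypothesis.\<close>
    proof (cases "w = []")
      case True
      with Cons.prems show ?thesis
        unfolding short_word_span_def by (intro span_base imageI) auto
    next
      case False
      with Cons have "eval_word b w \<in> short_word_span b N (Suc k)"
        by (auto simp: words_def)
      then show ?thesis
        using short_word_span_left_mult[OF \<open>i < N\<close>] assms(3) False
        by (fastforce simp: eval_word_Cons)
    qed
  qed
  then have "span (eval_word b ` words N) \<subseteq> short_word_span b N (Suc k)"
    by (intro span_minimal) (auto simp: short_word_span_def)
  then show ?thesis
    using span_words_UNIV[OF assms(1,2)] by auto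
qed

lemma short_word_span_UNIV:
  assumes "finite_dimensional_vector_space scale B"
    and "generates V" "V \<subseteq> span (b ` {..<N})"
  shows "short_word_span b N (dim (UNIV :: 'r set) - dim V + 1) = UNIV"
proof -
  interpret fd: finite_dimensional_vector_space scale B by fact
  let ?T = "short_word_span b N"
  have subspace: "subspace (?T k)" for k
    by (simp add: short_word_span_def)
  \<comment> \<open>The count starts with \<open>V\<close> inside \<open>T 1\<close>; from there on
    each proper inclusion of subspaces raises the dimension by at least one.\<close>
  have grow: "?T (Suc k) = UNIV \<or> dim V + k \<le> dim (?T (Suc k))" for k
  proof (induction k)
    case 0
    have "V \<subseteq> ?T (Suc 0)"
      using assms(3) span_subset_short_word_span_1[of b N] by simp
    then show ?case by (simp add: fd.dim_subset)
  next
    case (Suc k)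
    have sub: "?T (Suc k) \<subseteq> ?T (Suc (Suc k))"
      by (rule short_word_span_mono) simp
    show ?case
    proof (cases "?T (Suc k) = UNIV")
      case True
      with sub show ?thesis by auto
    next
      case False
      then have "?T (Suc k) \<noteq> ?T (Suc (Suc k))"
        using short_word_span_stable[OF assms(2,3)] by metis
      then have "\<not> dim (?T (Suc (Suc k))) \<le> dim (?T (Suc k))"
        using fd.subspace_dim_equal[OF subspace subspace sub] by blast
      with Suc.IH False show ?thesis by auto
    qed
  qed
  \<comment> \<open>This makes the truncated subtraction exact: at
    \<open>k = dim UNIV - dim V\<close> the lower bound in \<open>grow\<close> is
    \<open>dim UNIV\<close>, so \<open>?T (Suc k)\<close> is the whole space.\<close>
  have "dim V \<le> dim (UNIV :: 'r set)"
    by (rule fd.dim_subset) simp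
  with grow[of "dim (UNIV :: 'r set) - dim V"] show ?thesis
    using fd.subspace_dim_equal[OF subspace subspace_UNIV subset_UNIV] by auto
qed

section \<open>Substitution of words for variables\<close>

text \<open>A sum of monomials, because distinct words may have the same image; their coefficients
  then add up and may cancel.\<close>

definition subst_words :: "(nat \<Rightarrow> nat list) \<Rightarrow> 'f free_algebra \<Rightarrow> 'f free_algebra" where
  "subst_words u f =
     (\<Sum>w\<in>Poly_Mapping.keys f. Poly_Mapping.single (concat (map u w)) (Poly_Mapping.lookup f w))"

lemma keys_subst_words:
  "Poly_Mapping.keys (subst_words u f) \<subseteq> (\<lambda>w. concat (map u w)) ` Poly_Mapping.keys f"
  unfolding subst_words_def
  by (rule order.trans[OF keys_sum]) (auto split: if_splits)

lemma subst_words_polys: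
  assumes "f \<in> polys n" "\<And>i. i < n \<Longrightarrow> u i \<in> words N"
  shows "subst_words u f \<in> polys N"
proof -
  have "concat (map u w) \<in> words N" if "w \<in> Poly_Mapping.keys f" for w
  proof -
    have w: "w \<in> words n"
      using assms(1) that polys_iff_keys_subset_words by blast
    have "u i \<in> words N" if "i \<in> set w" for i
      using w that by (intro assms(2)) (auto simp: words_def)
    then have "set (concat (map u w)) \<subseteq> {..<N}"
      by (fastforce simp: words_def)
    moreover have "concat (map u w) \<noteq> []" if "one_opt = None"
    proof -
      have "w \<noteq> []" using w that unfolding words_def by blast
      then obtain i where "i \<in> set w" by fastforce
      moreover from this have "u i \<noteq> []"
        using \<open>\<And>i. i \<in> set w \<Longrightarrow> u i \<in> words N\<close> that unfolding words_def by blast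
      ultimately show ?thesis by auto
    qed
    ultimately show ?thesis by (simp add: words_def)
  qed
  then show ?thesis
    using keys_subst_words[of u f] by (auto simp: polys_iff_keys_subset_words)
qed

lemma eval_poly_subst_words:
  assumes "f \<in> polys n" "\<And>i. i < n \<Longrightarrow> u i \<in> words N"
  shows "eval_poly v (subst_words u f) = eval_poly (\<lambda>i. eval_word v (u i)) f"
  unfolding subst_words_def eval_poly_sum eval_poly_single eval_poly_def[of _ f]
proof (intro sum.cong refl arg_cong2[where f = scale] eval_word_concat)
  fix w
  assume w: "w \<in> Poly_Mapping.keys f" and "one_opt = None"
  then have "u i \<noteq> []" if "i < n" for i
    using assms(2)[OF that] unfolding words_def by blast
  with assms(1) w \<open>one_opt = None\<close> show "w \<noteq> [] \<and> (\<forall>i\<in>set w. u i \<noteq> [])"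
    unfolding polys_def by blast
qed

text \<open>Each monomial of \<open>c\<close> contains every variable exactly once, so each
  \<open>u i\<close> contributes its length once and the result is homogeneous.\<close>

lemma multilinear_length_subst_words:
  assumes "multilinear n c" "c \<in> polys n" "w \<in> Poly_Mapping.keys (subst_words u c)"
  shows "length w = (\<Sum>i<n. length (u i))"
proof -
  obtain w' where w': "w' \<in> Poly_Mapping.keys c" "w = concat (map u w')"
    using assms(3) keys_subst_words by blast
  have "set w' = {..<n}" "\<And>i. i < n \<Longrightarrow> count_list w' i = 1"
    using multilinear_keys[OF assms(1) _ w'(1)] assms(2) by (auto simp: polys_def)
  then show ?thesis
    using w'(2) by (simp add: length_concat comp_def sum_list_map_eq_sum_count)
qed

section \<open>The case where all substituted words are empty\<close>

text \<open>Putting \<open>e\<close> for all variables but the first turns \<open>c\<close> into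
  \<open>a *s x\<close>, where \<open>a\<close> is the sum of the coefficients. The value at
  \<open>x = e\<close> shows \<open>a \<noteq> 0\<close>, and dividing by \<open>a\<close> makes
  \<open>x\<close> itself central.\<close>

lemma multilinear_central_imp_commutative:
  assumes "one_opt = Some e" "n \<ge> 1" "multilinear n c"
    and central: "\<And>v. eval_poly v c \<in> ring_center"
    and "eval_poly (\<lambda>_. e) c \<noteq> 0"
  shows "(x :: 'r) \<in> ring_center"
proof -
  define a where "a = (\<Sum>w\<in>Poly_Mapping.keys c. Poly_Mapping.lookup c w)"
  have eval: "eval_poly ((\<lambda>_. e)(0 := x)) c = a *s x" for x
  proof -
    have "count_list w 0 = 1" if "w \<in> Poly_Mapping.keys c" for w
      using assms(2,3) that by (auto simp: multilinear_def)
    then show ?thesis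
      by (simp add: eval_poly_def a_def eval_word_one_upd[OF assms(1)] scale_sum_left)
  qed
  have "(\<lambda>_. e)(0 := e) = (\<lambda>_::nat. e)" by auto
  with eval[of e] assms(5) have "a \<noteq> 0" by auto
  then have "x = inverse a *s (a *s x)" by simp
  also have "\<dots> \<in> ring_center"
    using central[of "(\<lambda>_. e)(0 := x)"] unfolding eval
    by (simp add: ring_center_def scale_mult_left scale_mult_right)
  finally show ?thesis .
qed

lemma commutative_linear_central_polynomial:
  assumes "one_opt = Some e" "\<And>x. x \<in> (ring_center :: 'r set)" "e \<noteq> 0" "0 \<in> V"
  obtains c' where "central_polynomial_for V 1 c'" "poly_degree c' = 1"
proof -
  let ?c = "Poly_Mapping.single [0] 1 + Poly_Mapping.single [] 1 :: 'f free_algebra"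
  have keys: "Poly_Mapping.keys ?c = {[0], []}"
    by (auto simp: in_keys_iff lookup_add lookup_single when_def split: if_splits)
  have poly: "?c \<in> polys 1"
    by (subst polys_def) (simp add: keys assms(1))
  have "eval_word v [] = e" for v
    using assms(1) by (metis unital_obtain option.inject option.distinct(1))
  \<comment> \<open>The zero assignment is available in every subspace, and there only the constant
    term survives.\<close>
  then have "eval_poly (\<lambda>_. 0) ?c = e"
    by (simp add: eval_poly_add eval_poly_single)
  then have "\<not> identity_for V 1 ?c"
    using assms(3,4) by (auto simp: identity_for_def)
  with poly assms(2) have "central_polynomial_for V 1 ?c"
    by (auto simp: central_polynomial_for_def)
  moreover have "poly_degree ?c = 1"
    by (rule poly_degree_eqI[where w = "[0]"]) (auto simp: keys)
  ultimately show thesis by (rule that)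
qed

section \<open>The weak central polynomial and its degree\<close>

lemma weak_central_polynomial_degree_bound:
  assumes "ring_center \<noteq> ({0} :: 'r set)" "subspace V" "generates V" "n \<ge> 1"
    and "multilinear n c" "central_polynomial_for UNIV n c"
    and "finite A" "span A = UNIV"
  shows "\<exists>N c'. central_polynomial_for V N c' \<and> 1 \<le> poly_degree c' \<and>
           poly_degree c' \<le> n * (dim (UNIV :: 'r set) - dim V + 1)"
proof -
  let ?k = "dim (UNIV :: 'r set) - dim V + 1"
  obtain B where B: "finite_dimensional_vector_space scale B"
    using finite_spanning_set_imp_basis[OF assms(7,8)] .
  obtain b and N :: nat where b: "b ` {..<N} \<subseteq> V" "V \<subseteq> span (b ` {..<N})"
    using finite_dimensional_vector_space.subspace_finite_enumeration[OF B assms(2)] .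
  have c: "c \<in> polys n" "\<And>v. eval_poly v c \<in> ring_center" "\<exists>v. eval_poly v c \<noteq> 0"
    using assms(6) by (auto simp: central_polynomial_for_def identity_for_def)
  have span: "span (eval_word b ` {w \<in> words N. length w \<le> ?k}) = UNIV"
    using short_word_span_UNIV[OF B assms(3) b(2)] by (simp add: short_word_span_def)
  from c(3) obtain v where "eval_poly v c \<noteq> 0" ..
  from multilinear_nonzero_on_spanning_set[OF assms(5) span this]
  obtain r where r: "\<forall>i<n. r i \<in> eval_word b ` {w \<in> words N. length w \<le> ?k}"
    and r0: "eval_poly r c \<noteq> 0"
    by blast
  \<comment> \<open>The values \<open>r i\<close> are lifted to words \<open>u i\<close>, so that
    substituting \<open>u\<close> into \<open>c\<close> and evaluating at \<open>b\<close> gives the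
    value of \<open>c\<close> at \<open>r\<close>.\<close>
  have "\<forall>i. \<exists>w. i < n \<longrightarrow> w \<in> words N \<and> length w \<le> ?k \<and> r i = eval_word b w"
    using r by auto
  from choice[OF this] obtain u where
    "\<forall>i. i < n \<longrightarrow> u i \<in> words N \<and> length (u i) \<le> ?k \<and> r i = eval_word b (u i)" ..
  then have u: "\<And>i. i < n \<Longrightarrow> u i \<in> words N" "\<And>i. i < n \<Longrightarrow> length (u i) \<le> ?k"
    "\<And>i. i < n \<Longrightarrow> r i = eval_word b (u i)"
    by simp_all
  let ?c = "subst_words u c"
  let ?L = "\<Sum>i<n. length (u i)"
  have eval: "eval_poly v ?c = eval_poly (\<lambda>i. eval_word v (u i)) c" for v
    by (rule eval_poly_subst_words[OF c(1) u(1)])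
  have nonzero: "eval_poly (\<lambda>i. eval_word b (u i)) c \<noteq> 0"
    using r0 u(3) eval_poly_cong[OF c(1), of r "\<lambda>i. eval_word b (u i)"] by simp
  then have "\<not> identity_for V N ?c"
    using b(1) eval[of b] by (auto simp: identity_for_def intro!: exI[of _ b])
  then have central: "central_polynomial_for V N ?c"
    using subst_words_polys[OF c(1) u(1)] c(2) eval by (simp add: central_polynomial_for_def)
  \<comment> \<open>A nonzero value ensures that some monomial survives the substitution; as all
    monomials have length \<open>?L\<close>, this is the degree.\<close>
  have "Poly_Mapping.keys ?c \<noteq> {}"
    using nonzero eval[of b] by (auto simp: eval_poly_def[of b])
  then obtain w where w: "w \<in> Poly_Mapping.keys ?c" by blast
  have degree: "poly_degree ?c = ?L"
    using multilinear_length_subst_words[OF assms(5) c(1)] w by (intro poly_degree_eqI) auto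
  have "?L \<le> (\<Sum>i<n. ?k)"
    by (intro sum_mono u(2)) simp
  then have bound: "?L \<le> n * ?k" by simp
  show ?thesis
  proof (cases "?L = 0")
    case False
    then have "1 \<le> ?L" by linarith
    with central bound show ?thesis
      unfolding degree[symmetric] by blast
  next
    case True
    then have empty: "u i = []" if "i < n" for i
      using that by simp
    \<comment> \<open>Since \<open>n \<ge> 1\<close>, the empty word \<open>u 0\<close> is among the
      admissible words, which forces an identity to exist.\<close>
    with u(1)[of 0] assms(4) have "one_opt \<noteq> None"
      by (auto simp: words_def)
    then obtain e where e: "one_opt = Some e" and nil: "\<And>v. eval_word v [] = e"
      using unital_obtain by blast
    have "eval_poly (\<lambda>_. e) c \<noteq> 0"
      using nonzero empty nil eval_poly_cong[OF c(1), of "\<lambda>i. eval_word b (u i)" "\<lambda>_. e"] by simp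
    then have comm: "x \<in> ring_center" for x :: 'r
      by (rule multilinear_central_imp_commutative[OF e assms(4,5) c(2)])
    \<comment> \<open>With \<open>e = 0\<close> the algebra would be zero and its center
      \<open>{0}\<close>, against the non-trivial center.\<close>
    have "e \<noteq> 0"
    proof
      assume "e = 0"
      then have "x = 0" for x :: 'r
        using one_left[OF e, of x] by simp
      then show False
        using assms(1) comm by blast
    qed
    then obtain c' where "central_polynomial_for V 1 c'" "poly_degree c' = 1"
      using commutative_linear_central_polynomial[OF e comm _ subspace_0[OF assms(2)]] by blast
    moreover have "1 \<le> n * ?k"
      using assms(4) by simp
    ultimately show ?thesis
      by (intro exI[of _ 1] exI[of _ c']) simp
  qed
qed

end

theorem theorem2p4:
  fixes scale :: "'f::field \<Rightarrow> 'r::ring \<Rightarrow> 'r"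
    and one_opt :: "'r option"
    and V :: "'r set"
    and c :: "'f free_algebra"
    and n d m :: nat
  assumes "assoc_algebra scale one_opt"
    and "ring_center \<noteq> ({0} :: 'r set)"
    and "module.subspace scale V"
    and "assoc_algebra.generates scale one_opt V"
    and "n \<ge> 1"
    and "multilinear n c"
    and "assoc_algebra.central_polynomial_for scale one_opt UNIV n c"
    and "\<exists>B. finite B \<and> module.span scale B = UNIV"
    and "vector_space.dim scale (UNIV :: 'r set) = d"
    and "vector_space.dim scale V = m"
  shows "\<exists>N c'. assoc_algebra.central_polynomial_for scale one_opt V N c' \<and>
           1 \<le> poly_degree c' \<and> poly_degree c' \<le> n * (d - m + 1)"
proof -
  from assms(8) obtain A where "finite A" "module.span scale A = UNIV" by blast
  from assoc_algebra.weak_central_polynomial_degree_bound[OF assms(1-7) this]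
  show ?thesis unfolding assms(9,10) .
qed

end
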